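(* Let $G_1, G_2, \ldots$ be a countable sequence of arbitrary finite groups and let $d = lev_{\gamma,\theta}$ (with $\gamma,\theta>0$) be a generalized Levenshtein distance. Then there exists a language $L\subset\{0,1\}^*$ with growth $O(n)$ such that $Isom_d(L)\cong\prod_{n=1}^\infty G_n$.
   Context: For a finite alphabet $A$, $A^*$ is the set of all finite words over $A$ (including the empty word), and a language is a subset of $A^*$; $|w|$ is the length of the word $w$. The growth of a language $L$ is the function $n\mapsto|\{w\in L : |w|\leq n\}|$. For real $\gamma,\theta>0$ the generalized Levenshtein distance with insertion (equivalently, removal) weight $\gamma$ and replacement weight $\theta$ is $$lev_{\gamma,\theta}(u,v)=\min\{\gamma n+\theta m \mid u \text{ can be transformed into } v \text{ by } n \text{ insertions or deletions of single characters and } m \text{ replacements of single characters}\}$$ where the intermediate words are arbitrary words of $A^*$. It is a metric on $A^*$. $Isom_d(L)$ is the group (under composition) of all bijections $\phi:L\to L$ with $d(\phi(u),\phi(v))=d(u,v)$ for all $u,v\in L$. $\prod$ denotes the (unrestricted) Cartesian product of groups. *)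

theory Defs
  imports
    "HOL-Algebra.Bij"
    "HOL-Algebra.Product_Groups"
    "HOL-Library.Landau_Symbols"
begin

text \<open>
  Words over an alphabet are lists, the alphabet being the type of their letters;
  \<^typ>\<open>bool list\<close> plays the role of the binary words, with \<^const>\<open>False\<close> and \<^const>\<open>True\<close>
  as the letters 0 and 1.
\<close>

inductive indel :: "'a list \<Rightarrow> 'a list \<Rightarrow> bool" where
  insertion: "indel (xs @ ys) (xs @ a # ys)"
| deletion: "indel (xs @ a # ys) (xs @ ys)"

inductive replacement :: "'a list \<Rightarrow> 'a list \<Rightarrow> bool" where
  "replacement (xs @ a # ys) (xs @ b # ys)"

text \<open>
  \<open>edits u n m v\<close>: the word \<open>u\<close> can be transformed into \<open>v\<close> by \<open>n\<close> insertions or deletions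
  and \<open>m\<close> replacements, in any order.
\<close>

inductive edits :: "'a list \<Rightarrow> nat \<Rightarrow> nat \<Rightarrow> 'a list \<Rightarrow> bool" where
  edits_refl: "edits u 0 0 u"
| edits_indel: "edits u n m v \<Longrightarrow> indel v w \<Longrightarrow> edits u (Suc n) m w"
| edits_replacement: "edits u n m v \<Longrightarrow> replacement v w \<Longrightarrow> edits u n (Suc m) w"

text \<open>
  On the reals, \<open>LEAST\<close> denotes a minimum only if one exists; for positive weights this is
  \<open>lev_attained\<close> below.
\<close>

definition lev :: "real \<Rightarrow> real \<Rightarrow> 'a list \<Rightarrow> 'a list \<Rightarrow> real" where
  "lev \<gamma> \<theta> u v = (LEAST r. \<exists>n m. edits u n m v \<and> r = \<gamma> * real n + \<theta> * real m)"

lemma edits_exist: "\<exists>n. edits u n 0 v"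
proof -
  have del: "\<exists>n. edits u n 0 w" if "\<exists>n. edits u n 0 (w @ z)" for w z :: "'a list"
    using that
  proof (induction z rule: rev_induct)
    case (snoc a z)
    then obtain n where "edits u n 0 (w @ z @ [a])" by auto
    moreover have "indel (w @ z @ [a]) (w @ z)"
      using deletion[of "w @ z" a "[]"] by simp
    ultimately show ?case using snoc.IH edits_indel by blast
  qed simp
  have "\<exists>n. edits u n 0 ([] @ u)" using edits_refl by auto
  then have nil: "\<exists>n. edits u n 0 []" by (rule del)
  show ?thesis
  proof (induction v rule: rev_induct)
    case (snoc a v)
    have "indel v (v @ [a])" using insertion[of v "[]" a] by simp
    then show ?case using snoc edits_indel by blast
  qed (rule nil)
qed

lemma lev_attained:
  assumes "\<gamma> > 0" "\<theta> > 0"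
  shows "\<exists>n m. edits u n m v \<and> lev \<gamma> \<theta> u v = \<gamma> * real n + \<theta> * real m"
    and "edits u n m v \<Longrightarrow> lev \<gamma> \<theta> u v \<le> \<gamma> * real n + \<theta> * real m"
proof -
  define c where "c = (\<lambda>(n, m). \<gamma> * real n + \<theta> * real m)"
  obtain k where k: "edits u k 0 v" using edits_exist by blast
  define S where "S = {p. edits u (fst p) (snd p) v \<and> c p \<le> c (k, 0)}"
  have "S \<subseteq> {..nat \<lfloor>c (k, 0) / \<gamma>\<rfloor>} \<times> {..nat \<lfloor>c (k, 0) / \<theta>\<rfloor>}"
  proof
    fix p assume "p \<in> S"
    then have le: "\<gamma> * real (fst p) + \<theta> * real (snd p) \<le> c (k, 0)"
      by (auto simp: S_def c_def split: prod.splits)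
    moreover have "\<gamma> * real (fst p) \<ge> 0" "\<theta> * real (snd p) \<ge> 0" using assms by auto
    ultimately have "\<gamma> * real (fst p) \<le> c (k, 0)" "\<theta> * real (snd p) \<le> c (k, 0)"
      by linarith+
    then have "real (fst p) \<le> c (k, 0) / \<gamma>" "real (snd p) \<le> c (k, 0) / \<theta>"
      using assms by (simp_all add: field_simps)
    then show "p \<in> {..nat \<lfloor>c (k, 0) / \<gamma>\<rfloor>} \<times> {..nat \<lfloor>c (k, 0) / \<theta>\<rfloor>}"
      by (auto simp: mem_Times_iff le_nat_floor)
  qed
  then have fin: "finite S" by (rule finite_subset) simp
  have ne: "(k, 0) \<in> S" using k by (simp add: S_def)
  have "\<exists>p\<in>S. \<forall>q\<in>S. c p \<le> c q"
  proof -
    have "Min (c ` S) \<in> c ` S" using fin ne by (intro Min_in) auto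
    then obtain p where "p \<in> S" "c p = Min (c ` S)" by auto
    then show ?thesis using fin by (metis Min_le finite_imageI imageI)
  qed
  then obtain p where p: "p \<in> S" "\<And>q. q \<in> S \<Longrightarrow> c p \<le> c q" by blast
  have min: "c p \<le> \<gamma> * real n + \<theta> * real m" if "edits u n m v" for n m
  proof (cases "c (n, m) \<le> c (k, 0)")
    case True
    then have "(n, m) \<in> S" using that by (simp add: S_def)
    then show ?thesis using p(2) by (fastforce simp: c_def)
  next
    case False
    then show ?thesis using p(2)[OF ne] by (simp add: c_def)
  qed
  have edp: "edits u (fst p) (snd p) v" using p(1) by (simp add: S_def)
  have cp: "c p = \<gamma> * real (fst p) + \<theta> * real (snd p)" by (simp add: c_def split: prod.splits)
  have eq: "lev \<gamma> \<theta> u v = c p"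
    unfolding lev_def by (rule Least_equality) (use edp cp min in auto)
  show "\<exists>n m. edits u n m v \<and> lev \<gamma> \<theta> u v = \<gamma> * real n + \<theta> * real m"
    by (rule exI[of _ "fst p"], rule exI[of _ "snd p"]) (simp add: edp eq cp)
  show "edits u n m v \<Longrightarrow> lev \<gamma> \<theta> u v \<le> \<gamma> * real n + \<theta> * real m"
    using min eq by simp
qed

definition growth :: "'a list set \<Rightarrow> nat \<Rightarrow> nat" where
  "growth L n = card {w \<in> L. length w \<le> n}"

definition Isom :: "('w \<Rightarrow> 'w \<Rightarrow> real) \<Rightarrow> 'w set \<Rightarrow> ('w \<Rightarrow> 'w) monoid" where
  "Isom d L = (BijGroup L)
     \<lparr>carrier := {\<phi> \<in> Bij L. \<forall>u\<in>L. \<forall>v\<in>L. d (\<phi> u) (\<phi> v) = d u v}\<rparr>"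

lemma group_Isom: "group (Isom d L)"
proof -
  define I where "I = {\<phi> \<in> Bij L. \<forall>u\<in>L. \<forall>v\<in>L. d (\<phi> u) (\<phi> v) = d u v}"
  have I_iff: "f \<in> I \<longleftrightarrow> f \<in> Bij L \<and> (\<forall>u\<in>L. \<forall>v\<in>L. d (f u) (f v) = d u v)" for f
    by (simp add: I_def)
  have "subgroup I (BijGroup L)"
  proof (rule group.subgroupI[OF group_BijGroup])
    show "I \<subseteq> carrier (BijGroup L)" by (auto simp: I_def BijGroup_def)
    have "(\<lambda>x\<in>L. x) \<in> I" by (simp add: I_iff id_Bij)
    then show "I \<noteq> {}" by blast
  next
    fix a assume a: "a \<in> I"
    then have bij: "bij_betw a L L" by (simp add: I_iff Bij_def)
    have inv: "inv_into L a u \<in> L \<and> a (inv_into L a u) = u" if "u \<in> L" for u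
      using bij that by (simp add: bij_betw_def inv_into_into f_inv_into_f)
    have "d (inv_into L a u) (inv_into L a v) = d u v" if "u \<in> L" "v \<in> L" for u v
    proof -
      have "d (a (inv_into L a u)) (a (inv_into L a v)) = d (inv_into L a u) (inv_into L a v)"
        using a inv[OF that(1)] inv[OF that(2)] unfolding I_iff by blast
      then show ?thesis using inv that by simp
    qed
    then show "inv\<^bsub>BijGroup L\<^esub> a \<in> I"
      using a by (simp add: I_iff inv_BijGroup restrict_inv_into_Bij)
  next
    fix a b assume a: "a \<in> I" and b: "b \<in> I"
    have mem: "b u \<in> L" if "u \<in> L" for u
      using b that Bij_imp_funcset unfolding I_iff by blast
    have "d (compose L a b u) (compose L a b v) = d u v" if "u \<in> L" "v \<in> L" for u v
    proof -
      have "d (a (b u)) (a (b v)) = d (b u) (b v)" using a mem that unfolding I_iff by blast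
      also have "\<dots> = d u v" using b that unfolding I_iff by blast
      finally show ?thesis using that by (simp add: compose_def)
    qed
    then show "a \<otimes>\<^bsub>BijGroup L\<^esub> b \<in> I"
      using a b unfolding I_iff by (simp add: BijGroup_def compose_Bij)
  qed
  then show ?thesis
    unfolding Isom_def I_def[symmetric]
    by (rule subgroup.subgroup_is_group) (rule group_BijGroup)
qed

end

theory Submission
  imports Defs "HOL-Library.Sublist"
begin

text \<open>
  A word that consists of many long runs has a rigid run structure: if only runs whose numbers
  are multiples of a large \<open>K\<close> are changed, and only by small amounts, then the cheapest way to
  transform one such word into another is to lengthen and shorten these runs letter by letter.
  Hence every finite set of integer vectors with the \<open>\<ell>\<^sub>1\<close> distance, scaled by \<open>\<gamma>\<close>, is isometric
  to a set of words.

  For a finite group \<open>G\<close> take the vectors \<open>y \<mapsto> f (g\<^sup>-\<^sup>1 y)\<close> with \<open>g \<in> G\<close>, once for a multiple \<open>f\<close> of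
  the indicator of the unit and once for an injective \<open>f\<close>. Left translations preserve all
  distances, and since the distance of two vectors of different kinds determines the quotient of
  their group elements, no other bijection preserves both the kinds and the distances.

  The gadgets of different groups are placed at such different scales that each word is a
  subsequence of each word of a later gadget, so that their distance depends on the lengths only.
  Finally the words \<open>[]\<close> and \<open>[False]\<close> are added. They form the only pair at distance at most
  \<open>\<gamma>\<close> and cannot be exchanged, so isometries fix the empty word, hence preserve lengths, and
  therefore act on each gadget separately by a left translation.
\<close>

section \<open>Edits and the Levenshtein distance\<close>

lemma edits_trans:
  assumes "edits v n' m' w" "edits u n m v"
  shows "edits u (n + n') (m + m') w"
  using assms
  by (induction) (auto intro: edits.intros)

lemma indel_sym: "indel u v \<Longrightarrow> indel v u"
  by (auto elim!: indel.cases intro: indel.intros)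

lemma replacement_sym: "replacement u v \<Longrightarrow> replacement v u"
  by (auto elim!: replacement.cases intro: replacement.intros)

lemma edits_sym: "edits u n m v \<Longrightarrow> edits v n m u"
proof (induction rule: edits.induct)
  case (edits_refl u)
  show ?case by (rule edits.edits_refl)
next
  case (edits_indel u n m v w)
  have "edits w (Suc 0) 0 v"
    using edits.edits_indel[OF edits.edits_refl] indel_sym edits_indel.hyps by blast
  then show ?case using edits_trans[OF edits_indel.IH] by fastforce
next
  case (edits_replacement u n m v w)
  have "edits w 0 (Suc 0) v"
    using edits.edits_replacement[OF edits.edits_refl] replacement_sym edits_replacement.hyps by blast
  then show ?case using edits_trans[OF edits_replacement.IH] by fastforce
qed

lemma lev_sym: "lev \<gamma> \<theta> u v = lev \<gamma> \<theta> v u"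
proof -
  have "edits u n m v \<longleftrightarrow> edits v n m u" for n m using edits_sym by blast
  then show ?thesis by (simp add: lev_def)
qed

lemma indel_append: "indel u v \<Longrightarrow> indel (p @ u @ q) (p @ v @ q)"
  using insertion[of "p @ _" "_ @ q"] deletion[of "p @ _" _ "_ @ q"]
  by (auto elim!: indel.cases)

lemma replacement_append: "replacement u v \<Longrightarrow> replacement (p @ u @ q) (p @ v @ q)"
  using replacement.intros[of "p @ _" _ "_ @ q"]
  by (auto elim!: replacement.cases)

lemma edits_context: "edits u n m v \<Longrightarrow> edits (p @ u @ q) n m (p @ v @ q)"
  by (induction rule: edits.induct)
    (blast intro: edits.intros indel_append replacement_append)+

lemma edits_append:
  assumes "edits u n m v" "edits u' n' m' v'"
  shows "edits (u @ u') (n + n') (m + m') (v @ v')"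
  using edits_trans[of "v @ u'" n' m' "v @ v'" "u @ u'" n m]
    edits_context[OF assms(2), of v "[]"] edits_context[OF assms(1), of "[]" u'] by simp

lemma indel_append_split:
  assumes "indel (x @ y) w"
  shows "\<exists>x' y'. w = x' @ y' \<and> (indel x x' \<and> y' = y \<or> x' = x \<and> indel y y')"
  using assms
proof cases
  case (insertion xs ys a)
  then consider us where "x = xs @ us" "us @ y = ys" | us where "x @ us = xs" "y = us @ ys"
    by (auto simp: append_eq_append_conv2)
  then show ?thesis
  proof cases
    case 1
    with insertion indel.insertion[of xs us a] show ?thesis
      by (intro exI[of _ "xs @ a # us"] exI[of _ y]) auto
  next
    case 2
    with insertion indel.insertion[of us ys a] show ?thesis
      by (intro exI[of _ x] exI[of _ "us @ a # ys"]) auto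
  qed
next
  case (deletion xs a ys)
  then consider us where "x = xs @ a # us" "us @ y = ys" | us where "x @ us = xs" "y = us @ a # ys"
    by (auto simp: append_eq_append_conv2 append_eq_Cons_conv)
  then show ?thesis
  proof cases
    case 1
    with deletion indel.deletion[of xs a us] show ?thesis
      by (intro exI[of _ "xs @ us"] exI[of _ y]) auto
  next
    case 2
    with deletion indel.deletion[of us a ys] show ?thesis
      by (intro exI[of _ x] exI[of _ "us @ ys"]) auto
  qed
qed

lemma replacement_append_split:
  assumes "replacement (x @ y) w"
  shows "\<exists>x' y'. w = x' @ y' \<and> (replacement x x' \<and> y' = y \<or> x' = x \<and> replacement y y')"
  using assms
proof cases
  case (1 xs a ys b)
  then consider us where "x = xs @ a # us" "us @ y = ys" | us where "x @ us = xs" "y = us @ a # ys"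
    by (auto simp: append_eq_append_conv2 append_eq_Cons_conv)
  then show ?thesis
  proof cases
    case 2: 1
    with 1 replacement.intros[of xs a us b] show ?thesis
      by (intro exI[of _ "xs @ b # us"] exI[of _ y]) auto
  next
    case 2
    with 1 replacement.intros[of us a ys b] show ?thesis
      by (intro exI[of _ x] exI[of _ "us @ b # ys"]) auto
  qed
qed

lemma edits_append_split:
  assumes "edits (x @ y) n m w"
  obtains x' y' n1 n2 m1 m2 where "w = x' @ y'" "edits x n1 m1 x'" "edits y n2 m2 y'"
    "n = n1 + n2" "m = m1 + m2"
proof -
  have "\<exists>x' y' n1 n2 m1 m2. w = x' @ y' \<and> edits x n1 m1 x' \<and> edits y n2 m2 y' \<and>
      n = n1 + n2 \<and> m = m1 + m2"
    using assms
  proof (induction "x @ y" n m w rule: edits.induct)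
    case edits_refl
    show ?case
      by (rule exI[of _ x], rule exI[of _ y]) (auto intro: edits.edits_refl)
  next
    case (edits_indel n m v w)
    then obtain x' y' n1 n2 m1 m2 where v: "v = x' @ y'" "edits x n1 m1 x'" "edits y n2 m2 y'"
      "n = n1 + n2" "m = m1 + m2" by blast
    have "indel (x' @ y') w" using \<open>indel v w\<close> v(1) by simp
    from indel_append_split[OF this] obtain x'' y'' where "w = x'' @ y''"
      "indel x' x'' \<and> y'' = y' \<or> x'' = x' \<and> indel y' y''"
      by blast
    from this(2) show ?case
    proof
      assume "indel x' x'' \<and> y'' = y'"
      then have "edits x (Suc n1) m1 x''" using v(2,3) edits.edits_indel by blast
      then show ?case using v \<open>w = x'' @ y''\<close> \<open>indel x' x'' \<and> y'' = y'\<close> by (metis add_Suc)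
    next
      assume "x'' = x' \<and> indel y' y''"
      then have "edits y (Suc n2) m2 y''" using v(2,3) edits.edits_indel by blast
      then show ?case using v \<open>w = x'' @ y''\<close> \<open>x'' = x' \<and> indel y' y''\<close> by (metis add_Suc_right)
    qed
  next
    case (edits_replacement n m v w)
    then obtain x' y' n1 n2 m1 m2 where v: "v = x' @ y'" "edits x n1 m1 x'" "edits y n2 m2 y'"
      "n = n1 + n2" "m = m1 + m2" by blast
    have "replacement (x' @ y') w" using \<open>replacement v w\<close> v(1) by simp
    from replacement_append_split[OF this] obtain x'' y'' where "w = x'' @ y''"
      "replacement x' x'' \<and> y'' = y' \<or> x'' = x' \<and> replacement y' y''"
      by blast
    from this(2) show ?case
    proof
      assume "replacement x' x'' \<and> y'' = y'"
      then have "edits x n1 (Suc m1) x''" using v(2,3) edits.edits_replacement by blast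
      then show ?case using v \<open>w = x'' @ y''\<close> \<open>replacement x' x'' \<and> y'' = y'\<close> by (metis add_Suc)
    next
      assume "x'' = x' \<and> replacement y' y''"
      then have "edits y n2 (Suc m2) y''" using v(2,3) edits.edits_replacement by blast
      then show ?case using v \<open>w = x'' @ y''\<close> \<open>x'' = x' \<and> replacement y' y''\<close> by (metis add_Suc_right)
    qed
  qed
  then show thesis using that by blast
qed

lemma edits_weight:
  fixes f :: "'a \<Rightarrow> real"
  assumes "edits u n m v" and f: "\<And>z. \<bar>f z\<bar> \<le> 1" "\<And>y z. \<bar>f y - f z\<bar> \<le> \<epsilon>"
  shows "\<bar>sum_list (map f u) - sum_list (map f v)\<bar> \<le> real n + \<epsilon> * real m"
  using assms(1)
proof (induction rule: edits.induct)
  case (edits_indel u n m v w)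
  have "\<bar>sum_list (map f v) - sum_list (map f w)\<bar> \<le> 1"
    using edits_indel.hyps(2) f(1) by (auto elim!: indel.cases)
  then show ?case using edits_indel.IH by simp
next
  case (edits_replacement u n m v w)
  have "\<bar>sum_list (map f v) - sum_list (map f w)\<bar> \<le> \<epsilon>"
    using edits_replacement.hyps(2) f(2) by (auto elim!: replacement.cases)
  then show ?case using edits_replacement.IH by (simp add: algebra_simps)
qed simp

lemma edits_length:
  assumes "edits u n m v"
  shows "\<bar>real (length u) - real (length v)\<bar> \<le> real n"
  using edits_weight[OF assms, of "\<lambda>_. 1" 0] by (simp add: sum_list_triv)

lemma edits_count:
  assumes "edits u n m v"
  shows "\<bar>real (count_list u y) - real (count_list v y)\<bar> \<le> real (n + m)"
proof -
  have "sum_list (map (\<lambda>z. if z = y then 1 else 0) w) = real (count_list w y)" for w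
    by (induction w) auto
  then show ?thesis
    using edits_weight[OF assms, of "\<lambda>z. if z = y then 1 else 0" 1] by simp
qed

lemma edits_subseq: "subseq u v \<Longrightarrow> edits u (length v - length u) 0 v"
proof (induction u v rule: list_emb.induct)
  case (list_emb_Nil v)
  show ?case
  proof (induction v rule: rev_induct)
    case (snoc a v)
    then show ?case using edits_indel insertion[of v "[]" a] by fastforce
  qed (simp add: edits_refl)
next
  case (list_emb_Cons u v y)
  have "edits (y # v) (Suc 0) 0 v" "edits v (Suc 0) 0 (y # v)"
    using edits.edits_indel[OF edits.edits_refl] deletion[of "[]" y v] insertion[of "[]" v y] by auto
  moreover have "length u \<le> length v"
    using list_emb_Cons.hyps list_emb_length by blast
  ultimately show ?case
    using edits_trans[OF _ list_emb_Cons.IH, of "Suc 0" 0 "y # v"] by (simp add: Suc_diff_le)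
next
  case (list_emb_Cons2 x y u v)
  then show ?case
    using edits_context[of u _ 0 v "[x]" "[]"] by simp
qed

context
  fixes \<gamma> \<theta> :: real
  assumes pos: "\<gamma> > 0" "\<theta> > 0"
begin

lemma lev_ge_length: "lev \<gamma> \<theta> u v \<ge> \<gamma> * \<bar>real (length u) - real (length v)\<bar>"
proof -
  obtain n m where e: "edits u n m v" "lev \<gamma> \<theta> u v = \<gamma> * real n + \<theta> * real m"
    using lev_attained(1)[OF pos] by blast
  have "\<gamma> * \<bar>real (length u) - real (length v)\<bar> \<le> \<gamma> * real n"
    using edits_length[OF e(1)] pos by simp
  also have "\<dots> \<le> lev \<gamma> \<theta> u v" using e(2) pos by simp
  finally show ?thesis .
qed

lemma lev_subseq:
  assumes "subseq u v"
  shows "lev \<gamma> \<theta> u v = \<gamma> * \<bar>real (length u) - real (length v)\<bar>"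
proof (rule antisym[OF _ lev_ge_length])
  show "lev \<gamma> \<theta> u v \<le> \<gamma> * \<bar>real (length u) - real (length v)\<bar>"
    using lev_attained(2)[OF pos edits_subseq[OF assms]] list_emb_length[OF assms] by simp
qed

end

section \<open>Words given by their run lengths\<close>

primrec runs :: "bool \<Rightarrow> nat list \<Rightarrow> bool list" where
  "runs x [] = []"
| "runs x (a # as) = replicate a x @ runs (\<not> x) as"

lemma length_runs: "length (runs x as) = sum_list as"
  by (induction as arbitrary: x) auto

lemma subseq_runs:
  assumes "2 * length w \<le> length as" "\<And>a. a \<in> set as \<Longrightarrow> 0 < a"
  shows "subseq w (runs x as)"
  using assms
proof (induction w arbitrary: as)
  case (Cons c w)
  obtain a b cs where as: "as = a # b # cs"
    using Cons.prems(1) by (cases as rule: list.exhaust[case_names Nil Cons])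
      (auto simp: Suc_le_length_iff)
  have "c = x \<or> c = (\<not> x)" by auto
  moreover have "0 < a" "0 < b" using Cons.prems(2) as by auto
  ultimately have "subseq [c] (replicate a x @ replicate b (\<not> x))"
    by (auto simp: subseq_singleton_left)
  moreover have "subseq w (runs x cs)"
    using Cons.prems as by (intro Cons.IH) auto
  ultimately have "subseq ([c] @ w) ((replicate a x @ replicate b (\<not> x)) @ runs x cs)"
    by (rule list_emb_append_mono)
  then show ?case using as by simp
qed simp

lemma edits_replicate: "edits (replicate a x) (nat \<bar>int a - int b\<bar>) 0 (replicate b x)"
proof -
  have *: "edits (replicate a x) (b - a) 0 (replicate b x)" if "a \<le> b" for a b
  proof -
    have "subseq (replicate a x) (replicate a x @ replicate (b - a) x)"
      by (rule subseq_rev_drop_many) simp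
    then show ?thesis using edits_subseq that
      by (metis le_add_diff_inverse length_replicate replicate_add)
  qed
  show ?thesis
    using *[of a b] edits_sym[OF *[of b a]]
    by (cases "a \<le> b") (auto simp: nat_diff_distrib)
qed

lemma edits_runs:
  "length as = length bs \<Longrightarrow>
    edits (runs x as) (\<Sum>i<length as. nat \<bar>int (as ! i) - int (bs ! i)\<bar>) 0 (runs x bs)"
proof (induction as bs arbitrary: x rule: list_induct2)
  case (Cons a as b bs)
  show ?case
    using edits_append[OF edits_replicate[of a x b] Cons.IH[of "\<not> x"]]
    by (simp only: sum.lessThan_Suc_shift length_Cons runs.simps nth_Cons_0 nth_Cons_Suc add_0_right)
qed (simp add: edits_refl)

lemma count_list_replicate: "count_list (replicate n x) y = (if x = y then n else 0)"
  by (induction n) auto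

text \<open>
  Each letter of the \<open>i\<close>-th run gets the weight \<open>s i\<close>, so an indel changes the total weight by at
  most \<open>1\<close>, and a replacement, which moves a letter to an adjacent run, by at most \<open>\<epsilon>\<close>. To keep
  track of the runs, the word is cut within its second run: what precedes the cut can only be
  edited into a word that ends within the second run of the target.
\<close>

lemma edits_runs_weight:
  fixes s :: "nat \<Rightarrow> real"
  assumes "length as = length bs" "edits (runs x (a # as)) n m (runs x (b # bs))" "n + m < M"
    and "\<forall>c\<in>set as. M \<le> c" "\<forall>c\<in>set bs. 2 * M \<le> c"
    and "\<And>i. \<bar>s i\<bar> \<le> 1" "\<And>i. \<bar>s i - s (Suc i)\<bar> \<le> \<epsilon>"
  shows "(\<Sum>i\<le>length as. s i * (real ((a # as) ! i) - real ((b # bs) ! i))) \<le> real n + \<epsilon> * real m"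
  using assms
proof (induction as bs arbitrary: x a b n m s rule: list_induct2')
  case (1 x a b n m s)
  then have e: "edits (replicate a x) n m (replicate b x)" by simp
  have "\<epsilon> \<ge> 0" using "1.prems"(7)[of 0] by linarith
  then show ?case using edits_weight[OF e, of "\<lambda>_. s 0" \<epsilon>] "1.prems"(6)[of 0]
    by (simp add: sum_list_replicate algebra_simps)
next
  case (4 a' as b' bs x a b n m s)
  have eps: "\<epsilon> \<ge> 0" using "4.prems"(7)[of 0] by linarith
  define f where "f = (\<lambda>z. if z = x then s 0 else s 1)"
  have f: "\<bar>f z\<bar> \<le> 1" "\<bar>f y - f z\<bar> \<le> \<epsilon>" for y z
    using "4.prems"(6)[of 0] "4.prems"(6)[of 1] "4.prems"(7)[of 0] eps
    by (auto simp: f_def abs_minus_commute)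
  have a': "M \<le> a'" and b': "2 * M \<le> b'" using "4.prems" by auto
  define y where "y = (\<not> x)"
  have xy: "x \<noteq> y" "y \<noteq> x" "f x = s 0" "f y = s 1" by (auto simp: y_def f_def)
  have "runs x (a # a' # as) = (replicate a x @ replicate M y) @ runs y ((a' - M) # as)"
    using a' replicate_add[of M "a' - M" y] by (simp add: y_def)
  then obtain v1 v2 n1 n2 m1 m2 where v: "runs x (b # b' # bs) = v1 @ v2"
    and e1: "edits (replicate a x @ replicate M y) n1 m1 v1"
    and e2: "edits (runs y ((a' - M) # as)) n2 m2 v2"
    and nm: "n = n1 + n2" "m = m1 + m2"
    using "4.prems"(2) edits_append_split by metis
  have "\<bar>real M - real (count_list v1 y)\<bar> \<le> real (n1 + m1)"
    using edits_count[OF e1, of y] xy by (simp add: count_list_replicate)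
  then have cnt: "0 < count_list v1 y" "count_list v1 y < b'"
    using "4.prems"(3) nm b' by linarith+
  let ?R = "runs (\<not> y) bs"
  have "v1 @ v2 = replicate b x @ (replicate b' y @ ?R)"
    using v by (simp add: y_def)
  moreover have "v1 @ us \<noteq> replicate b x" for us
    using cnt(1) xy by (auto simp: count_list_replicate dest!: arg_cong[of _ _ "\<lambda>w. count_list w y"])
  ultimately obtain us where us: "v1 = replicate b x @ us" "us @ v2 = replicate b' y @ ?R"
    by (auto simp: append_eq_append_conv2)
  then obtain ws where ws: "us @ ws = replicate b' y" "v2 = ws @ ?R"
    using cnt(2) by (auto simp: append_eq_append_conv2 count_list_replicate)
  define t where "t = length us"
  have t: "us = replicate t y" "ws = replicate (b' - t) y" "t \<le> b'"
    using ws(1) arg_cong[OF ws(1), of length] by (auto simp: t_def append_eq_conv_conj min_def)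
  have v2: "v2 = runs y ((b' - t) # bs)" using ws(2) t by simp
  have 1: "s 0 * a + s 1 * M - (s 0 * b + s 1 * t) \<le> real n1 + \<epsilon> * real m1"
    using edits_weight[OF e1, of f \<epsilon>] f us t xy by (simp add: sum_list_replicate algebra_simps)
  have "(\<Sum>i\<le>length as. s (Suc i) * (real (((a' - M) # as) ! i) - real (((b' - t) # bs) ! i)))
      \<le> real n2 + \<epsilon> * real m2"
  proof (rule "4.IH"[where s = "\<lambda>i. s (Suc i)" and x = y])
    show "edits (runs y ((a' - M) # as)) n2 m2 (runs y ((b' - t) # bs))" using e2 v2 by simp
    show "n2 + m2 < M" using "4.prems"(3) nm by simp
    show "\<forall>c\<in>set as. M \<le> c" "\<forall>c\<in>set bs. 2 * M \<le> c" using "4.prems"(4,5) by auto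
  qed (use "4.prems" in simp_all)
  then have 2: "s 1 * (real a' - real M - (real b' - real t)) +
      (\<Sum>i<length as. s (Suc (Suc i)) * (real (as ! i) - real (bs ! i))) \<le> real n2 + \<epsilon> * real m2"
    unfolding sum.atMost_shift using a' t by (simp add: of_nat_diff)
  have "(\<Sum>i\<le>length (a' # as). s i * (real ((a # a' # as) ! i) - real ((b # b' # bs) ! i))) =
      s 0 * (real a - real b) + (s 1 * (real a' - real b') +
      (\<Sum>i<length as. s (Suc (Suc i)) * (real (as ! i) - real (bs ! i))))"
    unfolding length_Cons sum.atMost_Suc_shift sum.atMost_shift[of _ "length as"] by simp
  with 1 2 nm show ?case by (simp add: algebra_simps)
qed simp_all

section \<open>Integer vectors as words\<close>

text \<open>
  The run that codes the coordinate \<open>q\<close> has number \<open>K * q\<close>; the \<open>K - 1\<close> runs between two such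
  runs make it too expensive to trade one coordinate against another by replacements.
\<close>

definition vrun :: "nat \<Rightarrow> nat \<Rightarrow> (nat \<Rightarrow> nat) \<Rightarrow> nat \<Rightarrow> nat" where
  "vrun K T f r = T + (if K dvd r then f (r div K) else 0)"

definition vword :: "nat \<Rightarrow> nat \<Rightarrow> nat \<Rightarrow> (nat \<Rightarrow> nat) \<Rightarrow> bool list" where
  "vword K T k f = runs False (map (vrun K T f) [0..<K * k])"

lemma sum_vrun:
  fixes h :: "nat \<Rightarrow> nat \<Rightarrow> 'a :: comm_monoid_add"
  assumes "K > 0"
  shows "(\<Sum>r<K * k. if K dvd r then h r (r div K) else 0) = (\<Sum>q<k. h (K * q) q)"
proof -
  have "(\<Sum>r<K * k. if K dvd r then h r (r div K) else 0) =
      (\<Sum>r\<in>(*) K ` {..<k}. if K dvd r then h r (r div K) else 0)"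
    using assms by (intro sum.mono_neutral_right) auto
  also have "\<dots> = (\<Sum>q<k. h (K * q) q)"
    using assms by (subst sum.reindex) (auto simp: inj_on_def)
  finally show ?thesis .
qed

lemma length_vword:
  assumes "K > 0"
  shows "length (vword K T k f) = K * k * T + (\<Sum>q<k. f q)"
proof -
  have "length (vword K T k f) = (\<Sum>r<K * k. vrun K T f r)"
    by (simp add: vword_def length_runs interv_sum_list_conv_sum_set_nat atLeast0LessThan)
  then show ?thesis
    using sum_vrun[OF assms, where h = "\<lambda>_. f"] by (simp add: vrun_def sum.distrib)
qed

lemma interpolation:
  fixes \<sigma> :: "nat \<Rightarrow> real"
  assumes "K > 0" "\<And>q. \<bar>\<sigma> q\<bar> \<le> 1"
  obtains s :: "nat \<Rightarrow> real" where "\<And>q. s (K * q) = \<sigma> q" "\<And>i. \<bar>s i\<bar> \<le> 1"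
    "\<And>i. \<bar>s i - s (Suc i)\<bar> \<le> 2 / real K"
proof
  define s where "s = (\<lambda>r. \<sigma> (r div K) +
    (\<sigma> (Suc (r div K)) - \<sigma> (r div K)) * (real (r mod K) / real K))"
  show "s (K * q) = \<sigma> q" for q using assms by (simp add: s_def)
  show "\<bar>s i\<bar> \<le> 1" for i
  proof -
    define p where "p = real (i mod K) / real K"
    have p: "0 \<le> p" "p \<le> 1"
      using assms(1) by (auto simp: p_def divide_le_eq_1 less_imp_le)
    have "\<bar>s i\<bar> = \<bar>\<sigma> (i div K) * (1 - p) + \<sigma> (Suc (i div K)) * p\<bar>"
      by (simp add: s_def p_def algebra_simps)
    also have "\<dots> \<le> \<bar>\<sigma> (i div K)\<bar> * (1 - p) + \<bar>\<sigma> (Suc (i div K))\<bar> * p"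
      using p by (auto simp: abs_mult intro: order_trans[OF abs_triangle_ineq])
    also have "\<dots> \<le> 1 * (1 - p) + 1 * p"
      using p assms(2) by (intro add_mono mult_right_mono) auto
    finally show ?thesis by simp
  qed
  show "\<bar>s i - s (Suc i)\<bar> \<le> 2 / real K" for i
  proof -
    have "s (Suc i) - s i = (\<sigma> (Suc (i div K)) - \<sigma> (i div K)) / real K"
    proof (cases "Suc (i mod K) = K")
      case True
      then have "Suc i mod K = 0" "Suc i div K = Suc (i div K)" "real (i mod K) = real K - 1"
        by (auto simp: mod_Suc div_Suc)
      then have r: "real (i mod K) / real K = 1 - 1 / real K"
        using assms(1) by (simp add: diff_divide_distrib)
      have "s (Suc i) = \<sigma> (Suc (i div K))"
        using \<open>Suc i mod K = 0\<close> \<open>Suc i div K = Suc (i div K)\<close> by (simp add: s_def)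
      moreover have "s i = \<sigma> (i div K) + (\<sigma> (Suc (i div K)) - \<sigma> (i div K)) * (1 - 1 / real K)"
        by (simp only: s_def r)
      ultimately show ?thesis by (simp add: algebra_simps diff_divide_distrib)
    next
      case False
      then have "Suc i mod K = Suc (i mod K)" "Suc i div K = i div K"
        by (auto simp: mod_Suc div_Suc)
      then show ?thesis using assms(1) by (simp add: s_def field_simps)
    qed
    moreover have "\<bar>\<sigma> (Suc (i div K)) - \<sigma> (i div K)\<bar> \<le> 2"
      using assms(2)[of "i div K"] assms(2)[of "Suc (i div K)"] by linarith
    ultimately show ?thesis
      using assms(1) by (simp add: abs_minus_commute[of "s i"] divide_right_mono)
  qed
qed

lemma lev_vword:
  assumes pos: "\<gamma> > 0" "\<theta> > 0" and K: "K > 0" "2 * \<gamma> \<le> \<theta> * real K"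
    and D: "D = (\<Sum>q<k. \<bar>real (f q) - real (g q)\<bar>)"
    and M: "\<gamma> * D \<le> min \<gamma> \<theta> * real M" "2 * M \<le> T"
  shows "lev \<gamma> \<theta> (vword K T k f) (vword K T k g) = \<gamma> * D"
proof (rule antisym)
  let ?u = "vword K T k f" and ?v = "vword K T k g"
  have "edits ?u (\<Sum>r<K * k. nat \<bar>int (vrun K T f r) - int (vrun K T g r)\<bar>) 0 ?v"
    using edits_runs[of "map (vrun K T f) [0..<K * k]" "map (vrun K T g) [0..<K * k]" False]
    by (simp add: vword_def)
  also have "(\<Sum>r<K * k. nat \<bar>int (vrun K T f r) - int (vrun K T g r)\<bar>) =
      (\<Sum>r<K * k. if K dvd r then nat \<bar>int (f (r div K)) - int (g (r div K))\<bar> else 0)"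
    by (intro sum.cong) (auto simp: vrun_def)
  also have "\<dots> = (\<Sum>q<k. nat \<bar>int (f q) - int (g q)\<bar>)"
    using sum_vrun[OF K(1), where h = "\<lambda>_ q. nat \<bar>int (f q) - int (g q)\<bar>"] by simp
  finally have "lev \<gamma> \<theta> ?u ?v \<le> \<gamma> * real (\<Sum>q<k. nat \<bar>int (f q) - int (g q)\<bar>)"
    using lev_attained(2)[OF pos] by fastforce
  also have "real (\<Sum>q<k. nat \<bar>int (f q) - int (g q)\<bar>) = D"
    by (simp add: D)
  finally show "lev \<gamma> \<theta> ?u ?v \<le> \<gamma> * D" .
next
  let ?u = "vword K T k f" and ?v = "vword K T k g"
  obtain n m where e: "edits ?u n m ?v" and lev: "lev \<gamma> \<theta> ?u ?v = \<gamma> * real n + \<theta> * real m"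
    using lev_attained(1)[OF pos] by blast
  show "\<gamma> * D \<le> lev \<gamma> \<theta> ?u ?v"
  proof (cases "n + m < M \<and> k > 0")
    case True
    obtain s where s: "\<And>q. s (K * q) = sgn (real (f q) - real (g q))" "\<And>i. \<bar>s i\<bar> \<le> 1"
      "\<And>i. \<bar>s i - s (Suc i)\<bar> \<le> 2 / real K"
      using interpolation[OF K(1), of "\<lambda>q. sgn (real (f q) - real (g q))"] by (auto simp: abs_sgn_eq)
    obtain N where N: "K * k = Suc N" using K(1) True by (metis gr0_conv_Suc nat_0_less_mult_iff)
    have up: "map (vrun K T h) [0..<K * k] = vrun K T h 0 # map (vrun K T h) [1..<K * k]" for h
      using N by (simp add: upt_conv_Cons del: upt_Suc)
    have "(\<Sum>i\<le>length (map (vrun K T f) [1..<K * k]).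
        s i * (real (map (vrun K T f) [0..<K * k] ! i) - real (map (vrun K T g) [0..<K * k] ! i)))
        \<le> real n + 2 / real K * real m"
      using e True s(2,3) M(2) unfolding vword_def up
      by (intro edits_runs_weight[where x = False and M = M]) (auto simp: vrun_def)
    moreover have "length (map (vrun K T f) [1..<K * k]) = N" using N by simp
    ultimately have "(\<Sum>i\<le>N.
        s i * (real (map (vrun K T f) [0..<K * k] ! i) - real (map (vrun K T g) [0..<K * k] ! i)))
        \<le> real n + 2 / real K * real m"
      by (simp only:)
    moreover have "(\<Sum>i\<le>N. s i * (real (map (vrun K T f) [0..<K * k] ! i) - real (map (vrun K T g) [0..<K * k] ! i)))
      = (\<Sum>r<K * k. if K dvd r then s r * (real (f (r div K)) - real (g (r div K))) else 0)"
      unfolding N lessThan_Suc_atMost by (intro sum.cong) (auto simp: vrun_def simp del: upt_Suc)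
    moreover have "\<dots> = D"
      using sum_vrun[OF K(1), where h = "\<lambda>r q. s r * (real (f q) - real (g q))"]
      by (simp add: s D linordered_idom_class.abs_sgn mult.commute[of "sgn (_ :: real)"])
    ultimately have "\<gamma> * D \<le> \<gamma> * (real n + 2 / real K * real m)"
      using pos by simp
    also have "\<dots> = \<gamma> * real n + (2 * \<gamma> / real K) * real m" by (simp add: algebra_simps)
    also have "\<dots> \<le> lev \<gamma> \<theta> ?u ?v"
      unfolding lev using K by (intro add_left_mono mult_right_mono) (auto simp: field_simps)
    finally show ?thesis .
  next
    case False
    show ?thesis
    proof (cases "k = 0")
      case True
      then show ?thesis using lev pos D by simp
    next
      case False
      with \<open>\<not> (n + m < M \<and> k > 0)\<close> have "M \<le> n + m" by simp
      have "min \<gamma> \<theta> * real M \<le> min \<gamma> \<theta> * real (n + m)"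
        using pos \<open>M \<le> n + m\<close> by (intro mult_left_mono) auto
      also have "\<dots> \<le> lev \<gamma> \<theta> ?u ?v"
        unfolding lev of_nat_add distrib_left by (intro add_mono mult_right_mono) auto
      finally show ?thesis using M(1) by simp
    qed
  qed
qed

lemma subseq_vword:
  assumes "K > 0" "T > 0" "2 * length w \<le> k"
  shows "subseq w (vword K T k f)"
proof -
  have "k \<le> K * k" using assms(1) by simp
  with assms(3) have "2 * length w \<le> K * k" by (rule le_trans)
  then show ?thesis using assms unfolding vword_def
    by (intro subseq_runs) (auto simp: vrun_def)
qed

section \<open>Gadgets for finite groups\<close>

lemma (in group) sum_translate:
  assumes "x \<in> carrier G"
  shows "(\<Sum>y\<in>carrier G. f (x \<otimes> y)) = (\<Sum>y\<in>carrier G. f y)"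
proof -
  have "bij_betw ((\<otimes>) x) (carrier G) (carrier G)"
    using assms by (simp add: bij_betw_def inj_on_cmult surj_const_mult)
  then show ?thesis by (rule sum.reindex_bij_betw)
qed

text \<open>
  By the last condition, a distance-preserving bijection that preserves the two kinds of words
  \<open>c False g\<close> and \<open>c True g\<close> is a left translation. The condition on short words makes the
  distances to all words of length at most \<open>p\<close> depend on lengths only.
\<close>

definition gadget ::
  "('g, 'm) monoid_scheme \<Rightarrow> real \<Rightarrow> real \<Rightarrow> nat \<Rightarrow> (bool \<Rightarrow> 'g \<Rightarrow> bool list) \<Rightarrow> nat \<Rightarrow> bool" where
  "gadget G \<gamma> \<theta> p c l \<longleftrightarrow> p \<le> l \<and>
    (\<forall>i. \<forall>g\<in>carrier G. length (c i g) = l + (if i then 0 else 2)) \<and>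
    (\<forall>i. \<forall>g\<in>carrier G. \<forall>w. length w \<le> p \<longrightarrow> subseq w (c i g)) \<and>
    (\<forall>i j. \<forall>x\<in>carrier G. \<forall>g\<in>carrier G. \<forall>h\<in>carrier G.
      lev \<gamma> \<theta> (c i (x \<otimes>\<^bsub>G\<^esub> g)) (c j (x \<otimes>\<^bsub>G\<^esub> h)) = lev \<gamma> \<theta> (c i g) (c j h)) \<and>
    (\<forall>i. \<forall>g\<in>carrier G. \<forall>h\<in>carrier G. g \<noteq> h \<longrightarrow> 2 * \<gamma> \<le> lev \<gamma> \<theta> (c i g) (c i h)) \<and>
    (\<forall>g\<in>carrier G. \<forall>h\<in>carrier G. \<forall>g'\<in>carrier G. \<forall>h'\<in>carrier G.
      lev \<gamma> \<theta> (c False g) (c True h) = lev \<gamma> \<theta> (c False g') (c True h') \<longrightarrow>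
      inv\<^bsub>G\<^esub> h \<otimes>\<^bsub>G\<^esub> g = inv\<^bsub>G\<^esub> h' \<otimes>\<^bsub>G\<^esub> g')"

lemma (in group) gadget_exists:
  fixes \<gamma> \<theta> :: real
  assumes fin: "finite (carrier G)" and pos: "\<gamma> > 0" "\<theta> > 0"
  shows "\<exists>c l. gadget G \<gamma> \<theta> p c l"
proof -
  define k where "k = card (carrier G)"
  obtain e where e: "bij_betw e {..<k} (carrier G)"
    using ex_bij_betw_nat_finite[OF fin] by (auto simp: k_def atLeast0LessThan)
  obtain F :: "'a \<Rightarrow> nat" where F: "inj_on F (carrier G)"
    using finite_imp_inj_to_nat_seg[OF fin] by blast
  define S where "S = (\<Sum>y\<in>carrier G. F y)"
  define t where "t = S + 2"
  define \<psi> where "\<psi> = (\<lambda>i y. if i then F y else if y = \<one> then t else 0)"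
  have FS: "F y \<le> S" if "y \<in> carrier G" for y
    unfolding S_def using that fin by (intro member_le_sum) auto
  have \<psi>_le: "\<psi> i y \<le> t" if "y \<in> carrier G" for i y
    using FS[OF that] by (auto simp: \<psi>_def t_def)
  have \<psi>_sum: "(\<Sum>y\<in>carrier G. \<psi> i (inv g \<otimes> y)) = S + (if i then 0 else 2)"
    if "g \<in> carrier G" for i g
    using that fin sum_translate[of "inv g" "\<psi> i"] by (auto simp: \<psi>_def S_def t_def)
  define \<Delta> where "\<Delta> = (\<lambda>i j g h. \<Sum>y\<in>carrier G.
    \<bar>real (\<psi> i (inv g \<otimes> y)) - real (\<psi> j (inv h \<otimes> y))\<bar>)"
  have \<Delta>_le: "\<Delta> i j g h \<le> real (k * t)" if "g \<in> carrier G" "h \<in> carrier G" for i j g h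
  proof -
    have "\<Delta> i j g h \<le> (\<Sum>y\<in>carrier G. real t)"
      unfolding \<Delta>_def
    proof (rule sum_mono)
      fix y assume "y \<in> carrier G"
      then show "\<bar>real (\<psi> i (inv g \<otimes> y)) - real (\<psi> j (inv h \<otimes> y))\<bar> \<le> real t"
        using that \<psi>_le[of "inv g \<otimes> y" i] \<psi>_le[of "inv h \<otimes> y" j] by simp
    qed
    then show ?thesis by (simp add: k_def)
  qed
  have \<Delta>_translate: "\<Delta> i j (x \<otimes> g) (x \<otimes> h) = \<Delta> i j g h"
    if "x \<in> carrier G" "g \<in> carrier G" "h \<in> carrier G" for i j x g h
  proof -
    have "inv (x \<otimes> g') \<otimes> (x \<otimes> y) = inv g' \<otimes> y" if "g' \<in> carrier G" "y \<in> carrier G" for g' y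
      using that \<open>x \<in> carrier G\<close> by (simp add: inv_mult_group m_assoc flip: m_assoc[of "inv x" x y])
    then show ?thesis
      using that sum_translate[of x "\<lambda>y. \<bar>real (\<psi> i (inv (x \<otimes> g) \<otimes> y)) - real (\<psi> j (inv (x \<otimes> h) \<otimes> y))\<bar>"]
      by (simp add: \<Delta>_def)
  qed
  have inv_eq: "inv g \<otimes> y = \<one> \<longleftrightarrow> y = g" if "g \<in> carrier G" "y \<in> carrier G" for g y
    using that by (metis inv_closed inv_equality inv_inv l_inv)
  have \<Delta>_layer: "2 \<le> \<Delta> i i g h" if "g \<in> carrier G" "h \<in> carrier G" "g \<noteq> h" for i g h
  proof -
    have "1 \<le> \<bar>real (\<psi> i (inv g \<otimes> y)) - real (\<psi> i (inv h \<otimes> y))\<bar>" if y: "y \<in> {g, h}" for y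
    proof -
      have "y \<in> carrier G" using y \<open>g \<in> carrier G\<close> \<open>h \<in> carrier G\<close> by auto
      moreover have "inv g \<noteq> inv h"
        using \<open>g \<in> carrier G\<close> \<open>h \<in> carrier G\<close> \<open>g \<noteq> h\<close> by (metis inv_inv)
      ultimately have "inv g \<otimes> y \<noteq> inv h \<otimes> y"
        using \<open>g \<in> carrier G\<close> \<open>h \<in> carrier G\<close> by simp
      then have "F (inv g \<otimes> y) \<noteq> F (inv h \<otimes> y)"
        using F \<open>g \<in> carrier G\<close> \<open>h \<in> carrier G\<close> \<open>y \<in> carrier G\<close>
        by (simp add: inj_on_eq_iff)
      moreover have "\<psi> False (inv g \<otimes> y) \<noteq> \<psi> False (inv h \<otimes> y)"
        using y that \<open>g \<in> carrier G\<close> \<open>h \<in> carrier G\<close> \<open>g \<noteq> h\<close>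
        by (auto simp: \<psi>_def inv_eq t_def)
      ultimately have "\<psi> i (inv g \<otimes> y) \<noteq> \<psi> i (inv h \<otimes> y)"
        by (cases i) (auto simp: \<psi>_def)
      then show ?thesis by linarith
    qed
    then have "(\<Sum>y\<in>{g, h}. 1) \<le> (\<Sum>y\<in>{g, h}. \<bar>real (\<psi> i (inv g \<otimes> y)) - real (\<psi> i (inv h \<otimes> y))\<bar>)"
      by (rule sum_mono)
    also have "\<dots> \<le> \<Delta> i i g h"
      unfolding \<Delta>_def using that fin by (intro sum_mono2) auto
    finally show ?thesis using that by simp
  qed
  have \<Delta>_link: "\<Delta> False True g h = real (S + t) - 2 * real (F (inv h \<otimes> g))"
    if "g \<in> carrier G" "h \<in> carrier G" for g h
  proof -
    have hg: "inv h \<otimes> g \<in> carrier G" using that by simp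
    have "\<Delta> False True g h = \<bar>real t - real (F (inv h \<otimes> g))\<bar> +
        (\<Sum>y\<in>carrier G - {g}. \<bar>real (\<psi> False (inv g \<otimes> y)) - real (\<psi> True (inv h \<otimes> y))\<bar>)"
      unfolding \<Delta>_def using that fin by (subst sum.remove[of _ g]) (auto simp: \<psi>_def)
    also have "\<dots> = real t - real (F (inv h \<otimes> g)) + (\<Sum>y\<in>carrier G - {g}. real (F (inv h \<otimes> y)))"
      using that FS[OF hg] by (intro arg_cong2[of _ _ _ _ "(+)"] sum.cong) (auto simp: \<psi>_def inv_eq t_def)
    also have "(\<Sum>y\<in>carrier G - {g}. real (F (inv h \<otimes> y))) = real S - real (F (inv h \<otimes> g))"
    proof -
      have "S = F (inv h \<otimes> g) + (\<Sum>y\<in>carrier G - {g}. F (inv h \<otimes> y))"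
        using that sum_translate[of "inv h" F] sum.remove[OF fin that(1), of "\<lambda>y. F (inv h \<otimes> y)"]
        by (simp add: S_def)
      then show ?thesis by simp
    qed
    finally show ?thesis by simp
  qed
  define K where "K = nat \<lceil>2 * \<gamma> / \<theta>\<rceil> + 1"
  define M where "M = nat \<lceil>\<gamma> * real (k * t) / min \<gamma> \<theta>\<rceil>"
  define T where "T = 2 * M + p + 1"
  define c where "c = (\<lambda>i g. vword K T (k + 2 * p) (\<lambda>q. if q < k then \<psi> i (inv g \<otimes> e q) else 0))"
  define l where "l = K * (k + 2 * p) * T + S"
  have K: "K > 0" "2 * \<gamma> \<le> \<theta> * real K"
  proof -
    have "2 * \<gamma> / \<theta> \<le> real K" unfolding K_def by linarith
    then show "2 * \<gamma> \<le> \<theta> * real K" using pos by (simp add: field_simps)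
  qed (simp add: K_def)
  have sum_e: "(\<Sum>q<k + 2 * p. if q < k then f (e q) else 0) = (\<Sum>y\<in>carrier G. f y)"
    for f :: "'a \<Rightarrow> 'c :: comm_monoid_add"
  proof -
    have "(\<Sum>q<k + 2 * p. if q < k then f (e q) else 0) = (\<Sum>q<k. f (e q))"
      by (rule sum.mono_neutral_cong_right) auto
    also have "\<dots> = (\<Sum>y\<in>carrier G. f y)" by (rule sum.reindex_bij_betw[OF e])
    finally show ?thesis .
  qed
  have lev_c: "lev \<gamma> \<theta> (c i g) (c j h) = \<gamma> * \<Delta> i j g h" if "g \<in> carrier G" "h \<in> carrier G" for i j g h
    unfolding c_def
  proof (rule lev_vword[OF pos K])
    show "\<Delta> i j g h = (\<Sum>q<k + 2 * p. \<bar>real (if q < k then \<psi> i (inv g \<otimes> e q) else 0) -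
        real (if q < k then \<psi> j (inv h \<otimes> e q) else 0)\<bar>)"
      unfolding \<Delta>_def sum_e[symmetric] by (intro sum.cong) auto
    have "\<gamma> * real (k * t) / min \<gamma> \<theta> \<le> real M" unfolding M_def by linarith
    then have "\<gamma> * real (k * t) \<le> min \<gamma> \<theta> * real M" using pos by (simp add: field_simps)
    then show "\<gamma> * \<Delta> i j g h \<le> min \<gamma> \<theta> * real M"
      using mult_left_mono[OF \<Delta>_le[OF that, of i j], of \<gamma>] pos by linarith
    show "2 * M \<le> T" by (simp add: T_def)
  qed
  have "k > 0" using fin by (auto simp: k_def card_gt_0_iff)
  have "p \<le> T * 1" by (simp add: T_def)
  also have "\<dots> \<le> T * (K * (k + 2 * p))" using K(1) \<open>k > 0\<close> by (intro mult_left_mono) auto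
  also have "\<dots> \<le> l" by (simp add: l_def mult_ac)
  finally have p_le: "p \<le> l" .
  have len: "length (c i g) = l + (if i then 0 else 2)" if "g \<in> carrier G" for i g
    using \<psi>_sum[OF that] sum_e[of "\<lambda>y. \<psi> i (inv g \<otimes> y)"] K(1)
    by (simp add: c_def l_def length_vword)
  have sub: "subseq w (c i g)" if "length w \<le> p" for i g w
    unfolding c_def using that K(1) by (intro subseq_vword) (auto simp: T_def)
  have link: "inv h \<otimes> g = inv h' \<otimes> g'"
    if *: "g \<in> carrier G" "h \<in> carrier G" "g' \<in> carrier G" "h' \<in> carrier G"
    and "lev \<gamma> \<theta> (c False g) (c True h) = lev \<gamma> \<theta> (c False g') (c True h')" for g h g' h'
  proof -
    have "F (inv h \<otimes> g) = F (inv h' \<otimes> g')"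
      using that pos by (simp add: lev_c \<Delta>_link)
    then show ?thesis using F * by (auto dest: inj_onD)
  qed
  have layer: "2 * \<gamma> \<le> lev \<gamma> \<theta> (c i g) (c i h)"
    if "g \<in> carrier G" "h \<in> carrier G" "g \<noteq> h" for i g h
    using \<Delta>_layer[OF that, of i] pos that by (simp add: lev_c)
  have translate: "lev \<gamma> \<theta> (c i (x \<otimes> g)) (c j (x \<otimes> h)) = lev \<gamma> \<theta> (c i g) (c j h)"
    if "x \<in> carrier G" "g \<in> carrier G" "h \<in> carrier G" for i j x g h
    using that by (simp add: lev_c \<Delta>_translate)
  show ?thesis
    unfolding gadget_def
    by (rule exI[of _ c], rule exI[of _ l], intro conjI ballI allI impI)
      (rule p_le len sub translate layer link; assumption)+
qed

section \<open>The union of the gadgets\<close>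

locale gadget_family =
  fixes G :: "nat \<Rightarrow> ('g, 'm) monoid_scheme" and \<gamma> \<theta> :: real
    and c :: "nat \<Rightarrow> bool \<Rightarrow> 'g \<Rightarrow> bool list" and p l :: "nat \<Rightarrow> nat"
  assumes pos: "\<gamma> > 0" "\<theta> > 0"
    and group_G: "n \<ge> 1 \<Longrightarrow> group (G n)"
    and finite_G: "n \<ge> 1 \<Longrightarrow> finite (carrier (G n))"
    and gadget: "n \<ge> 1 \<Longrightarrow> gadget (G n) \<gamma> \<theta> (p n) (c n) (l n)"
    and p_ge: "n \<ge> 1 \<Longrightarrow> 3 \<le> p n"
    and p_gap: "1 \<le> n \<Longrightarrow> n < m \<Longrightarrow> l n + 4 \<le> p m"
    and p_ge_card: "n \<ge> 1 \<Longrightarrow> (\<Sum>j=1..n. 2 * card (carrier (G j))) \<le> p n"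
begin

lemma p_le_l: "n \<ge> 1 \<Longrightarrow> p n \<le> l n"
  using gadget by (simp add: gadget_def)

lemma length_c: "n \<ge> 1 \<Longrightarrow> g \<in> carrier (G n) \<Longrightarrow> length (c n i g) = l n + (if i then 0 else 2)"
  using gadget[of n] by (simp add: gadget_def)

lemma l_ge: "n \<ge> 1 \<Longrightarrow> 3 \<le> l n"
  using p_ge p_le_l le_trans by blast

lemma l_gap: "1 \<le> n \<Longrightarrow> n < m \<Longrightarrow> l n + 4 \<le> l m"
  using p_gap[of n m] p_le_l[of m] by simp

lemma l_ge_card: "n \<ge> 1 \<Longrightarrow> (\<Sum>j=1..n. 2 * card (carrier (G j))) \<le> l n"
  using p_ge_card p_le_l le_trans by blast

lemma subseq_single: "n \<ge> 1 \<Longrightarrow> g \<in> carrier (G n) \<Longrightarrow> subseq [False] (c n i g)"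
  using gadget[of n] p_ge[of n] by (simp add: gadget_def)

lemma subseq_c:
  assumes "1 \<le> n" "n < m" "g \<in> carrier (G n)" "h \<in> carrier (G m)"
  shows "subseq (c n i g) (c m j h)"
proof -
  have "length (c n i g) \<le> p m" using length_c[of n g i] p_gap[of n m] assms by simp
  then show ?thesis using gadget[of m] assms by (simp add: gadget_def)
qed

lemma lev_translate:
  assumes "n \<ge> 1" "x \<in> carrier (G n)" "g \<in> carrier (G n)" "h \<in> carrier (G n)"
  shows "lev \<gamma> \<theta> (c n i (x \<otimes>\<^bsub>G n\<^esub> g)) (c n j (x \<otimes>\<^bsub>G n\<^esub> h)) = lev \<gamma> \<theta> (c n i g) (c n j h)"
  using gadget[OF assms(1)] assms(2-4) unfolding gadget_def by blast

lemma lev_layer: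
  assumes "n \<ge> 1" "g \<in> carrier (G n)" "h \<in> carrier (G n)" "g \<noteq> h"
  shows "2 * \<gamma> \<le> lev \<gamma> \<theta> (c n i g) (c n i h)"
  using gadget[OF assms(1)] assms(2-4) unfolding gadget_def by blast

lemma lev_link:
  assumes "n \<ge> 1" "g \<in> carrier (G n)" "h \<in> carrier (G n)" "g' \<in> carrier (G n)" "h' \<in> carrier (G n)"
    and "lev \<gamma> \<theta> (c n False g) (c n True h) = lev \<gamma> \<theta> (c n False g') (c n True h')"
  shows "inv\<^bsub>G n\<^esub> h \<otimes>\<^bsub>G n\<^esub> g = inv\<^bsub>G n\<^esub> h' \<otimes>\<^bsub>G n\<^esub> g'"
  using gadget[OF assms(1)] assms(2-6) unfolding gadget_def by blast

definition L :: "bool list set" where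
  "L = {[], [False]} \<union> {c n i g | n i g. n \<ge> 1 \<and> g \<in> carrier (G n)}"

lemma L_cases [consumes 1, case_names Nil single word]:
  assumes "w \<in> L"
  obtains "w = []" | "w = [False]" | n i g where "n \<ge> 1" "g \<in> carrier (G n)" "w = c n i g"
  using assms unfolding L_def by blast

lemma Nil_in_L: "[] \<in> L" and single_in_L: "[False] \<in> L"
  and c_in_L: "n \<ge> 1 \<Longrightarrow> g \<in> carrier (G n) \<Longrightarrow> c n i g \<in> L"
  by (auto simp: L_def)

lemma lev_self: "lev \<gamma> \<theta> w w = 0"
  using lev_subseq[OF pos, of w w] by simp

lemma lev_Nil: "lev \<gamma> \<theta> [] w = \<gamma> * real (length w)"
  using lev_subseq[OF pos, of "[]" w] by simp

lemma lev_single: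
  assumes "n \<ge> 1" "g \<in> carrier (G n)"
  shows "lev \<gamma> \<theta> [False] (c n i g) = \<gamma> * (real (length (c n i g)) - 1)"
  using lev_subseq[OF pos subseq_single[OF assms, of i]] l_ge[OF assms(1)]
    length_c[OF assms, of i] by simp

lemma length_c_diff:
  assumes "n \<ge> 1" "m \<ge> 1" "g \<in> carrier (G n)" "h \<in> carrier (G m)" "(n, i) \<noteq> (m, j)"
  shows "2 \<le> \<bar>real (length (c n i g)) - real (length (c m j h))\<bar>"
proof (cases n m rule: linorder_cases)
  case less
  then show ?thesis using l_gap[of n m] assms by (simp add: length_c)
next
  case equal
  then show ?thesis using assms by (auto simp: length_c)
next
  case greater
  then show ?thesis using l_gap[of m n] assms by (simp add: length_c)
qed

lemma lev_c_ge:
  assumes "n \<ge> 1" "m \<ge> 1" "g \<in> carrier (G n)" "h \<in> carrier (G m)" "(n, i, g) \<noteq> (m, j, h)"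
  shows "2 * \<gamma> \<le> lev \<gamma> \<theta> (c n i g) (c m j h)"
proof (cases "(n, i) = (m, j)")
  case True
  then show ?thesis using assms lev_layer by auto
next
  case False
  then have "2 * \<gamma> \<le> \<gamma> * \<bar>real (length (c n i g)) - real (length (c m j h))\<bar>"
    using length_c_diff[OF assms(1-4), of i j] pos by simp
  also have "\<dots> \<le> lev \<gamma> \<theta> (c n i g) (c m j h)" by (rule lev_ge_length[OF pos])
  finally show ?thesis .
qed

lemma c_inject:
  assumes "c n i g = c m j h" "n \<ge> 1" "m \<ge> 1" "g \<in> carrier (G n)" "h \<in> carrier (G m)"
  shows "n = m \<and> i = j \<and> g = h"
  using lev_c_ge[of n m g h i j] lev_self[of "c n i g"] assms pos by fastforce

lemma c_length_inject:
  assumes "length (c n i g) = length (c m j h)" "n \<ge> 1" "m \<ge> 1" "g \<in> carrier (G n)" "h \<in> carrier (G m)"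
  shows "n = m \<and> i = j"
  using length_c_diff[of n m g h i j] assms by fastforce

lemma c_length_ge: "n \<ge> 1 \<Longrightarrow> g \<in> carrier (G n) \<Longrightarrow> 3 \<le> length (c n i g)"
  using l_ge[of n] by (simp add: length_c)

lemma c_not_short: "n \<ge> 1 \<Longrightarrow> g \<in> carrier (G n) \<Longrightarrow> c n i g \<noteq> [] \<and> c n i g \<noteq> [False]"
  using c_length_ge[of n g i] by auto

lemma lev_c_cross:
  assumes "n \<ge> 1" "m \<ge> 1" "n \<noteq> m" "g \<in> carrier (G n)" "h \<in> carrier (G m)"
  shows "lev \<gamma> \<theta> (c n i g) (c m j h) = \<gamma> * \<bar>real (length (c n i g)) - real (length (c m j h))\<bar>"
proof (cases "n < m")
  case True
  then show ?thesis using lev_subseq[OF pos subseq_c] assms by blast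
next
  case False
  then have "lev \<gamma> \<theta> (c m j h) (c n i g) = \<gamma> * \<bar>real (length (c m j h)) - real (length (c n i g))\<bar>"
    using lev_subseq[OF pos subseq_c] assms by fastforce
  then show ?thesis by (simp add: lev_sym abs_minus_commute)
qed

lemma close_pair:
  assumes "u \<in> L" "v \<in> L" "u \<noteq> v" "lev \<gamma> \<theta> u v \<le> \<gamma>"
  shows "{u, v} = {[], [False]}"
proof -
  have far: "\<gamma> < lev \<gamma> \<theta> (c n i g) v" if "n \<ge> 1" "g \<in> carrier (G n)" "v \<in> L" "c n i g \<noteq> v" for n i g v
    using that(3)
  proof (cases rule: L_cases)
    case Nil
    then show ?thesis using lev_Nil[of "c n i g"] c_length_ge[OF that(1,2), of i] pos
      by (simp add: lev_sym[of _ _ _ "[]"])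
  next
    case single
    then show ?thesis using lev_single[OF that(1,2), of i] c_length_ge[OF that(1,2), of i] pos
      by (simp add: lev_sym[of _ _ _ "[False]"])
  next
    case (word m j h)
    then show ?thesis using lev_c_ge[of n m g h i j] that pos by fastforce
  qed
  have short: "u = [] \<or> u = [False]" if "u \<in> L" "v \<in> L" "u \<noteq> v" "lev \<gamma> \<theta> u v \<le> \<gamma>" for u v
    using that(1)
  proof (cases rule: L_cases)
    case (word n i g)
    then show ?thesis using far[of n g v i] that by simp
  qed simp_all
  have "u = [] \<or> u = [False]" "v = [] \<or> v = [False]"
    using short[of u v] short[of v u] assms by (simp_all add: lev_sym[of _ _ v u])
  then show ?thesis using assms(3) by auto
qed

lemma Isom_iff:
  "\<phi> \<in> carrier (Isom (lev \<gamma> \<theta>) L) \<longleftrightarrow>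
    bij_betw \<phi> L L \<and> \<phi> \<in> extensional L \<and> (\<forall>u\<in>L. \<forall>v\<in>L. lev \<gamma> \<theta> (\<phi> u) (\<phi> v) = lev \<gamma> \<theta> u v)"
  by (auto simp: Isom_def Bij_def)

lemma Isom_mult:
  assumes "\<phi> \<in> carrier (Isom (lev \<gamma> \<theta>) L)" "\<psi> \<in> carrier (Isom (lev \<gamma> \<theta>) L)"
  shows "\<phi> \<otimes>\<^bsub>Isom (lev \<gamma> \<theta>) L\<^esub> \<psi> = compose L \<phi> \<psi>"
  using assms by (simp add: Isom_def BijGroup_def)

lemma Isom_fixes_short:
  assumes "\<phi> \<in> carrier (Isom (lev \<gamma> \<theta>) L)"
  shows "\<phi> [] = []" "\<phi> [False] = [False]"
proof -
  have bij: "bij_betw \<phi> L L" and iso: "\<And>u v. u \<in> L \<Longrightarrow> v \<in> L \<Longrightarrow> lev \<gamma> \<theta> (\<phi> u) (\<phi> v) = lev \<gamma> \<theta> u v"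
    using assms by (auto simp: Isom_iff)
  have mem: "\<phi> u \<in> L" if "u \<in> L" for u using bij that by (auto simp: bij_betw_def)
  have inj: "\<phi> u = \<phi> v \<longleftrightarrow> u = v" if "u \<in> L" "v \<in> L" for u v
    using bij that by (auto simp: bij_betw_def inj_on_def)
  have pair: "{\<phi> [], \<phi> [False]} = {[], [False]}"
    by (rule close_pair) (simp_all add: mem inj iso Nil_in_L single_in_L lev_Nil)
  have "\<phi> [] \<noteq> [False]"
  proof
    assume 1: "\<phi> [] = [False]"
    then have 2: "\<phi> [False] = []" using pair by (auto simp: doubleton_eq_iff)
    define w where "w = c 1 True \<one>\<^bsub>G 1\<^esub>"
    have one: "\<one>\<^bsub>G 1\<^esub> \<in> carrier (G 1)"
      using group_G[of 1] by (simp add: group.is_monoid monoid.one_closed)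
    then have w: "w \<in> L" "w \<noteq> []" "w \<noteq> [False]" "length w = l 1"
      using c_in_L[of 1] c_not_short[of 1] length_c[of 1] by (auto simp: w_def)
    have "\<phi> w \<noteq> \<phi> []" "\<phi> w \<noteq> \<phi> [False]" using w inj Nil_in_L single_in_L by metis+
    then have "\<phi> w \<noteq> []" "\<phi> w \<noteq> [False]" using 1 2 by auto
    then obtain n i g where n: "n \<ge> 1" "g \<in> carrier (G n)" "\<phi> w = c n i g"
      using mem[OF w(1)] L_cases by metis
    have "l 1 \<le> l n" using l_gap[of 1 n] n(1) by (cases "n = 1") auto
    then have "l 1 \<le> length (\<phi> w)" using n by (simp add: length_c)
    moreover have "\<gamma> * real (length (\<phi> w)) = \<gamma> * (real (l 1) - 1)"
      using iso[OF single_in_L w(1)] lev_single[OF _ one, of True] w(4)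
      unfolding 2 lev_Nil by (simp add: w_def)
    then have "real (length (\<phi> w)) = real (l 1) - 1" using pos by simp
    ultimately show False by linarith
  qed
  then show "\<phi> [] = []" "\<phi> [False] = [False]" using pair by (auto simp: doubleton_eq_iff)
qed

lemma Isom_length:
  assumes "\<phi> \<in> carrier (Isom (lev \<gamma> \<theta>) L)" "w \<in> L"
  shows "length (\<phi> w) = length w"
proof -
  have "lev \<gamma> \<theta> (\<phi> []) (\<phi> w) = lev \<gamma> \<theta> [] w"
    using assms Nil_in_L by (simp add: Isom_iff)
  then show ?thesis using Isom_fixes_short[OF assms(1)] pos by (simp add: lev_Nil)
qed

lemma Isom_left_mult:
  assumes \<phi>: "\<phi> \<in> carrier (Isom (lev \<gamma> \<theta>) L)" and n: "n \<ge> 1"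
  shows "\<exists>x\<in>carrier (G n). \<forall>i. \<forall>g\<in>carrier (G n). \<phi> (c n i g) = c n i (x \<otimes>\<^bsub>G n\<^esub> g)"
proof -
  interpret Gn: group "G n" by (rule group_G[OF n])
  have "\<exists>g'\<in>carrier (G n). \<phi> (c n i g) = c n i g'" if g: "g \<in> carrier (G n)" for i g
  proof -
    have w: "c n i g \<in> L" by (rule c_in_L[OF n g])
    have len: "length (\<phi> (c n i g)) = length (c n i g)" by (rule Isom_length[OF \<phi> w])
    have "\<phi> (c n i g) \<in> L" using \<phi> w by (auto simp: Isom_iff bij_betw_def)
    then show ?thesis
    proof (cases rule: L_cases)
      case (word m j h)
      then show ?thesis using c_length_inject[of m j h n i g] len n g by auto
    qed (use len c_length_ge[OF n g, of i] in auto)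
  qed
  then have "\<forall>i g. \<exists>g'. g \<in> carrier (G n) \<longrightarrow> g' \<in> carrier (G n) \<and> \<phi> (c n i g) = c n i g'"
    by blast
  then obtain \<sigma> where "\<forall>i g. g \<in> carrier (G n) \<longrightarrow>
      \<sigma> i g \<in> carrier (G n) \<and> \<phi> (c n i g) = c n i (\<sigma> i g)"
    unfolding choice_iff by blast
  then have \<sigma>: "\<And>i g. g \<in> carrier (G n) \<Longrightarrow> \<sigma> i g \<in> carrier (G n)"
    "\<And>i g. g \<in> carrier (G n) \<Longrightarrow> \<phi> (c n i g) = c n i (\<sigma> i g)" by simp_all
  have link: "inv\<^bsub>G n\<^esub> (\<sigma> True h) \<otimes>\<^bsub>G n\<^esub> \<sigma> False g = inv\<^bsub>G n\<^esub> h \<otimes>\<^bsub>G n\<^esub> g"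
    if "g \<in> carrier (G n)" "h \<in> carrier (G n)" for g h
  proof (rule lev_link[OF n])
    have "lev \<gamma> \<theta> (\<phi> (c n False g)) (\<phi> (c n True h)) = lev \<gamma> \<theta> (c n False g) (c n True h)"
      using \<phi> c_in_L[OF n] that by (simp add: Isom_iff)
    then show "lev \<gamma> \<theta> (c n False (\<sigma> False g)) (c n True (\<sigma> True h)) =
        lev \<gamma> \<theta> (c n False g) (c n True h)"
      using that \<sigma>(2) by simp
  qed (use that \<sigma>(1) in auto)
  define x where "x = \<sigma> True \<one>\<^bsub>G n\<^esub>"
  have x: "x \<in> carrier (G n)" using \<sigma>(1) by (simp add: x_def)
  have F: "\<sigma> False g = x \<otimes>\<^bsub>G n\<^esub> g" if "g \<in> carrier (G n)" for g
  proof -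
    have "inv\<^bsub>G n\<^esub> x \<otimes>\<^bsub>G n\<^esub> \<sigma> False g = g"
      using link[OF that, of "\<one>\<^bsub>G n\<^esub>"] that by (simp add: x_def)
    then show ?thesis using x \<sigma>(1)[OF that, of False] that
      by (metis Gn.inv_solve_left)
  qed
  have T: "\<sigma> True g = \<sigma> False g" if "g \<in> carrier (G n)" for g
  proof -
    have "inv\<^bsub>G n\<^esub> (\<sigma> True g) \<otimes>\<^bsub>G n\<^esub> \<sigma> False g = \<one>\<^bsub>G n\<^esub>"
      using link[OF that that] that by simp
    then show ?thesis using \<sigma>(1)[OF that]
      by (metis Gn.inv_closed Gn.inv_equality Gn.inv_inv)
  qed
  have "\<sigma> i g = x \<otimes>\<^bsub>G n\<^esub> g" if "g \<in> carrier (G n)" for i g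
    using F T that by (cases i) auto
  then show ?thesis using x \<sigma>(2) by auto
qed

definition act :: "(nat \<Rightarrow> 'g) \<Rightarrow> bool list \<Rightarrow> bool list" where
  "act x = (\<lambda>w\<in>L. if w \<in> {[], [False]} then w
     else (THE v. \<exists>n i g. n \<ge> 1 \<and> g \<in> carrier (G n) \<and> w = c n i g \<and> v = c n i (x n \<otimes>\<^bsub>G n\<^esub> g)))"

lemma act_short: "act x [] = []" "act x [False] = [False]"
  by (auto simp: act_def L_def)

lemma act_c:
  assumes "n \<ge> 1" "g \<in> carrier (G n)"
  shows "act x (c n i g) = c n i (x n \<otimes>\<^bsub>G n\<^esub> g)"
proof -
  have "(THE v. \<exists>n' i' g'. n' \<ge> 1 \<and> g' \<in> carrier (G n') \<and> c n i g = c n' i' g' \<and>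
      v = c n' i' (x n' \<otimes>\<^bsub>G n'\<^esub> g')) = c n i (x n \<otimes>\<^bsub>G n\<^esub> g)"
    by (rule the_equality) (use assms in \<open>auto dest: c_inject\<close>)
  then show ?thesis using c_in_L[OF assms] c_not_short[OF assms] by (simp add: act_def)
qed

abbreviation P :: "(nat \<Rightarrow> 'g) monoid" where
  "P \<equiv> product_group {1..} G"

lemma component_closed: "x \<in> carrier P \<Longrightarrow> n \<ge> 1 \<Longrightarrow> x n \<in> carrier (G n)"
  by auto

lemma mult_closed: "n \<ge> 1 \<Longrightarrow> x \<in> carrier (G n) \<Longrightarrow> y \<in> carrier (G n) \<Longrightarrow> x \<otimes>\<^bsub>G n\<^esub> y \<in> carrier (G n)"
  using group_G by (simp add: group.is_monoid monoid.m_closed)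

lemma act_in_L:
  assumes "x \<in> carrier P" "w \<in> L"
  shows "act x w \<in> L"
  using assms(2)
proof (cases rule: L_cases)
  case (word n i g)
  then show ?thesis
    using act_c c_in_L mult_closed component_closed[OF assms(1)] by simp
qed (simp_all add: act_short Nil_in_L single_in_L)

lemma act_mult:
  assumes "x \<in> carrier P" "y \<in> carrier P"
  shows "act (x \<otimes>\<^bsub>P\<^esub> y) = compose L (act x) (act y)"
proof
  fix w
  show "act (x \<otimes>\<^bsub>P\<^esub> y) w = compose L (act x) (act y) w"
  proof (cases "w \<in> L")
    case True
    then show ?thesis
    proof (cases rule: L_cases)
      case (word n i g)
      then interpret Gn: group "G n" using group_G by simp
      show ?thesis
        using word True act_c mult_closed component_closed[OF assms(1)] component_closed[OF assms(2)]
        by (simp add: compose_def Gn.m_assoc)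
    qed (simp_all add: act_short compose_def Nil_in_L single_in_L)
  qed (simp add: act_def compose_def)
qed

lemma act_one:
  assumes "w \<in> L"
  shows "act \<one>\<^bsub>P\<^esub> w = w"
  using assms
proof (cases rule: L_cases)
  case (word n i g)
  then interpret Gn: group "G n" using group_G by simp
  show ?thesis using word by (simp add: act_c)
qed (simp_all add: act_short)

lemma group_P: "group P"
  using group_G by (intro product_group) simp

lemma length_act: 
  assumes "x \<in> carrier P" "w \<in> L"
  shows "length (act x w) = length w"
  using assms(2)
proof (cases rule: L_cases)
  case (word n i g)
  then show ?thesis using mult_closed component_closed[OF assms(1)] by (simp add: act_c length_c)
qed (simp_all add: act_short)

lemma lev_act:
  assumes x: "x \<in> carrier P" and "u \<in> L" "v \<in> L"
  shows "lev \<gamma> \<theta> (act x u) (act x v) = lev \<gamma> \<theta> u v"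
proof -
  have cl: "x n \<otimes>\<^bsub>G n\<^esub> g \<in> carrier (G n)" if "n \<ge> 1" "g \<in> carrier (G n)" for n g
    using that mult_closed component_closed[OF x] by simp
  have short: "lev \<gamma> \<theta> (act x u) (act x v) = lev \<gamma> \<theta> u v" if "u = [] \<or> u = [False]" "v \<in> L" for u v
    using that(2)
  proof (cases rule: L_cases)
    case (word n i g)
    then show ?thesis using that length_act[OF x] cl by (auto simp: act_short act_c lev_Nil lev_single length_c)
  qed (use that act_short in auto)
  show ?thesis
    using assms(2)
  proof (cases rule: L_cases)
    case u: (word n i g)
    show ?thesis
      using assms(3)
    proof (cases rule: L_cases)
      case v: (word m j h)
      show ?thesis
      proof (cases "n = m")
        case True
        then show ?thesis using u v lev_translate component_closed[OF x] by (simp add: act_c)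
      next
        case False
        then show ?thesis using u v cl by (simp add: act_c lev_c_cross length_c)
      qed
    qed (use short[of v u] assms lev_sym in \<open>auto simp: lev_sym\<close>)
  qed (use short[of u v] assms in auto)
qed

lemma act_in_Isom:
  assumes x: "x \<in> carrier P"
  shows "act x \<in> carrier (Isom (lev \<gamma> \<theta>) L)"
proof -
  interpret P: group P by (rule group_P)
  have inv: "inv\<^bsub>P\<^esub> x \<in> carrier P" using x by (rule P.inv_closed)
  have *: "act y (act z w) = w" if "y \<in> carrier P" "z \<in> carrier P" "y \<otimes>\<^bsub>P\<^esub> z = \<one>\<^bsub>P\<^esub>" "w \<in> L" for y z w
    using act_one[OF that(4)] act_mult[OF that(1,2)] that(4) unfolding that(3) by (simp add: compose_def)
  have "bij_betw (act x) L L"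
    by (rule bij_betw_byWitness[of L "act (inv\<^bsub>P\<^esub> x)"])
      (use * act_in_L x inv P.l_inv P.r_inv in blast)+
  moreover have "act x \<in> extensional L" by (simp add: act_def)
  ultimately show ?thesis using lev_act[OF x] by (simp add: Isom_iff)
qed

lemma act_iso: "act \<in> iso P (Isom (lev \<gamma> \<theta>) L)"
proof (rule isoI)
  show "act \<in> hom P (Isom (lev \<gamma> \<theta>) L)"
    using act_in_Isom act_mult by (intro homI) (simp_all only: Isom_mult)
  have "inj_on act (carrier P)"
  proof (rule inj_onI)
    fix x y assume x: "x \<in> carrier P" and y: "y \<in> carrier P" and eq: "act x = act y"
    show "x = y"
    proof
      fix n
      show "x n = y n"
      proof (cases "n \<ge> 1")
        case True
        then interpret Gn: group "G n" by (rule group_G)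
        have "x n \<in> carrier (G n)" "y n \<in> carrier (G n)"
          using component_closed x y True by blast+
        moreover from this have "c n True (x n) = c n True (y n)"
          using fun_cong[OF eq, of "c n True \<one>\<^bsub>G n\<^esub>"] True by (simp add: act_c)
        ultimately show ?thesis using c_inject[of n True "x n" n True "y n"] True by simp
      next
        case False
        then have n: "n \<notin> {1..}" by simp
        have "x \<in> extensional {1..}" "y \<in> extensional {1..}"
          using x y by (auto simp: PiE_def)
        then show ?thesis using extensional_arb[OF _ n] by metis
      qed
    qed
  qed
  moreover have "act ` carrier P = carrier (Isom (lev \<gamma> \<theta>) L)"
  proof
    show "act ` carrier P \<subseteq> carrier (Isom (lev \<gamma> \<theta>) L)" using act_in_Isom by blast
    show "carrier (Isom (lev \<gamma> \<theta>) L) \<subseteq> act ` carrier P"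
    proof
      fix \<phi> assume \<phi>: "\<phi> \<in> carrier (Isom (lev \<gamma> \<theta>) L)"
      obtain x where x: "\<And>n. n \<ge> 1 \<Longrightarrow> x n \<in> carrier (G n)"
        "\<And>n i g. n \<ge> 1 \<Longrightarrow> g \<in> carrier (G n) \<Longrightarrow> \<phi> (c n i g) = c n i (x n \<otimes>\<^bsub>G n\<^esub> g)"
        using Isom_left_mult[OF \<phi>] by metis
      define y where "y = restrict x {1..}"
      have "y \<in> carrier P" using x(1) by (auto simp: y_def)
      moreover have "\<phi> = act y"
      proof
        fix w
        show "\<phi> w = act y w"
        proof (cases "w \<in> L")
          case True
          then show ?thesis
          proof (cases rule: L_cases)
            case (word n i g)
            then show ?thesis using x(2) by (simp add: act_c y_def)
          qed (simp_all add: act_short Isom_fixes_short[OF \<phi>])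
        next
          case False
          then show ?thesis using \<phi> extensional_arb[of \<phi> L w] by (simp add: Isom_iff act_def)
        qed
      qed
      ultimately show "\<phi> \<in> act ` carrier P" by blast
    qed
  qed
  ultimately show "bij_betw act (carrier P) (carrier (Isom (lev \<gamma> \<theta>) L))"
    unfolding bij_betw_def ..
qed

lemma growth_L: "growth L m \<le> m + 2"
proof -
  define I where "I = {n. n \<ge> 1 \<and> l n \<le> m}"
  have "n \<le> l n" if "n \<ge> 1" for n
    using that
  proof (induction n rule: dec_induct)
    case (step n)
    then show ?case using l_gap[of n "Suc n"] by simp
  qed (use l_ge[of 1] in simp)
  then have "I \<subseteq> {..m}" by (auto simp: I_def intro: le_trans)
  then have fin: "finite I" by (rule finite_subset) simp
  define W where "W = (\<Union>n\<in>I. (\<lambda>(i, g). c n i g) ` (UNIV \<times> carrier (G n)))"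
  have finW: "finite W" using fin finite_G by (auto simp: W_def I_def)
  have "card W \<le> (\<Sum>n\<in>I. card ((\<lambda>(i, g). c n i g) ` (UNIV \<times> carrier (G n))))"
    unfolding W_def using fin by (rule card_UN_le)
  also have "\<dots> \<le> (\<Sum>n\<in>I. 2 * card (carrier (G n)))"
  proof (rule sum_mono)
    fix n assume "n \<in> I"
    then have "finite (UNIV \<times> carrier (G n) :: (bool \<times> 'g) set)" using finite_G by (auto simp: I_def)
    from card_image_le[OF this, of "\<lambda>(i, g). c n i g"]
    show "card ((\<lambda>(i, g). c n i g) ` (UNIV \<times> carrier (G n))) \<le> 2 * card (carrier (G n))"
      by (simp add: card_cartesian_product)
  qed
  also have "\<dots> \<le> m"
  proof (cases "I = {}")
    case False
    then have N: "Max I \<in> I" using fin by simp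
    have "(\<Sum>n\<in>I. 2 * card (carrier (G n))) \<le> (\<Sum>n=1..Max I. 2 * card (carrier (G n)))"
      using fin by (intro sum_mono2) (auto simp: I_def)
    also have "\<dots> \<le> l (Max I)" using l_ge_card N by (simp add: I_def)
    also have "\<dots> \<le> m" using N by (simp add: I_def)
    finally show ?thesis .
  qed simp
  finally have "card W \<le> m" .
  moreover have "card {[], [False]} = 2" by simp
  ultimately have "card ({[], [False]} \<union> W) \<le> m + 2"
    using card_Un_le[of "{[], [False]}" W] by linarith
  moreover have "{w \<in> L. length w \<le> m} \<subseteq> {[], [False]} \<union> W"
  proof
    fix w assume w: "w \<in> {w \<in> L. length w \<le> m}"
    then have "w \<in> L" by simp
    then show "w \<in> {[], [False]} \<union> W"
    proof (cases rule: L_cases)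
      case (word n i g)
      then have "n \<in> I" using w by (simp add: I_def length_c)
      moreover have "w \<in> (\<lambda>(i, g). c n i g) ` (UNIV \<times> carrier (G n))"
        using word by (intro image_eqI[of _ _ "(i, g)"]) auto
      ultimately show ?thesis unfolding W_def by blast
    qed simp_all
  qed
  then have "growth L m \<le> card ({[], [False]} \<union> W)"
    unfolding growth_def using finW by (intro card_mono) simp_all
  ultimately show ?thesis by linarith
qed

end

theorem theorem3:
  fixes G :: "nat \<Rightarrow> ('g, 'm) monoid_scheme" and \<gamma> \<theta> :: real
  assumes "\<And>n. n \<ge> 1 \<Longrightarrow> group (G n)"
    and "\<And>n. n \<ge> 1 \<Longrightarrow> finite (carrier (G n))"
    and "\<gamma> > 0" and "\<theta> > 0"
  shows "\<exists>L :: bool list set.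
           (\<lambda>n. real (growth L n)) \<in> O(\<lambda>n. real n) \<and>
           Isom (lev \<gamma> \<theta>) L \<cong> product_group {1..} G"
proof -
  have "\<forall>n p. \<exists>c l. n \<ge> 1 \<longrightarrow> gadget (G n) \<gamma> \<theta> p c l"
    using group.gadget_exists[OF assms(1) assms(2) assms(3,4)] by blast
  then obtain C Len where C: "\<And>n p. n \<ge> 1 \<Longrightarrow> gadget (G n) \<gamma> \<theta> p (C n p) (Len n p)"
    unfolding choice_iff by blast
  define B where "B = (\<lambda>n. \<Sum>j=1..n. 2 * card (carrier (G j)))"
  define q where "q = rec_nat 3 (\<lambda>n q. Len n (q + B n) + q + 4)"
  define p where "p = (\<lambda>n. q n + B n)"
  define l where "l = (\<lambda>n. Len n (p n))"
  have q_Suc: "q (Suc n) = l n + q n + 4" for n by (simp add: p_def q_def l_def)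
  have q_mono: "q n \<le> q m" if "n \<le> m" for n m
    by (rule lift_Suc_mono_le[OF _ that]) (simp add: q_Suc)
  have q_ge: "3 \<le> q n" for n using q_mono[of 0 n] by (simp add: q_def)
  have q_gap: "l n + 4 \<le> q m" if "n < m" for n m
    using q_mono[of "Suc n" m] that by (simp add: q_Suc)
  interpret gadget_family G \<gamma> \<theta> "\<lambda>n. C n (p n)" p l
  proof (rule gadget_family.intro)
    show "gadget (G n) \<gamma> \<theta> (p n) (C n (p n)) (l n)" if "n \<ge> 1" for n
      using C[OF that] by (simp add: l_def)
    show "3 \<le> p n" for n using q_ge[of n] by (simp add: p_def)
    show "l n + 4 \<le> p m" if "n < m" for n m using q_gap[OF that] by (simp add: p_def)
    show "(\<Sum>j=1..n. 2 * card (carrier (G j))) \<le> p n" for n by (simp add: p_def B_def)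
  qed (use assms in auto)
  have "(\<lambda>n. real (growth L n)) \<in> O(\<lambda>n. real n)"
  proof (rule bigoI[of _ 3])
    show "\<forall>\<^sub>F n in at_top. norm (real (growth L n)) \<le> 3 * norm (real n)"
      using eventually_ge_at_top[of 1]
    proof eventually_elim
      case (elim n)
      then show ?case using growth_L[of n] by simp
    qed
  qed
  moreover have "Isom (lev \<gamma> \<theta>) L \<cong> product_group {1..} G"
    using group.iso_sym[OF group_P] act_iso is_isoI by blast
  ultimately show ?thesis by blast
qed

end
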